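(* Let $\mathbb{F}$ be a field of characteristic zero, let $A$, $\tilde A$ be Gorenstein algebras over $\mathbb{F}$ of finite vector space dimension greater than $1$ with maximal ideals $\mathfrak{m}$, $\tilde{\mathfrak{m}}$, and let $\pi$, $\tilde\pi$ be admissible projections on $A$, $\tilde A$, respectively. Then $A$ and $\tilde A$ are isomorphic if and only if the hypersurfaces $S_{\pi}\subset\mathfrak{m}$ and $S_{\tilde\pi}\subset\tilde{\mathfrak{m}}$ are affinely equivalent. Moreover, if $\mathcal{A}:\mathfrak{m}\to\tilde{\mathfrak{m}}$ is an affine equivalence such that $\mathcal{A}(S_{\pi})=S_{\tilde\pi}$, then the linear part of $\mathcal{A}$ is an algebra isomorphism between $\mathfrak{m}$ and $\tilde{\mathfrak{m}}$.
   Context: All algebras are over a fixed field $\mathbb{F}$ of characteristic zero. A local commutative associative (unital) $\mathbb{F}$-algebra $A$ of finite vector space dimension greater than $1$ with maximal ideal $\mathfrak{m}$ is called Gorenstein if the annihilator $\mathrm{Ann}(\mathfrak{m}):=\{u\in\mathfrak{m}: u\,\mathfrak{m}=0\}$ has $\mathbb{F}$-dimension $1$. (In particular $A=\mathbb{F}\mathbf{1}\oplus\mathfrak{m}$, where $\mathbf{1}$ is the identity element of $A$.) Isomorphism means isomorphism of $\mathbb{F}$-algebras. An admissible projection on $A$ is a linear projection $\pi:A\to A$ (i.e. $\pi^2=\pi$) with range $\mathrm{Ann}(\mathfrak{m})$ and with $\mathbf{1}\in\ker\pi$. The ideal $\mathfrak{m}$ is nilpotent; $\nu\ge 1$ denotes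 the largest integer $\mu$ with $\mathfrak{m}^{\mu}\neq 0$. The map $\exp:\mathfrak{m}\to\mathbf{1}+\mathfrak{m}$, $\exp(u)=\sum_{m=0}^{\infty}\frac{1}{m!}u^m$ (a finite sum, $u^0:=\mathbf{1}$), is bijective with inverse $\log(\mathbf{1}+u)=\sum_{m=1}^{\nu}\frac{(-1)^{m+1}}{m}u^m$. Let $Q'_\pi:=\{a\in\mathbf{1}+\mathfrak{m}:\pi(a^2)=0\}$ and define $S_\pi:=2\log(Q'_\pi)=\{2\log(a): a\in Q'_\pi\}\subset\mathfrak{m}$. Equivalently, with $\mathcal{K}:=\ker\pi\cap\mathfrak{m}$, so that $\mathfrak{m}=\mathcal{K}\oplus\mathrm{Ann}(\mathfrak{m})$, $S_\pi$ is the graph $\{u+P_\pi(u):u\in\mathcal{K}\}$ of the polynomial map $P_\pi:\mathcal{K}\to\mathrm{Ann}(\mathfrak{m})$, $P_\pi(u):=-\pi(\exp(u))=-\pi\left(\sum_{m=2}^{\nu}\frac{1}{m!}u^m\right)$. The set $S_{\tilde\pi}\subset\tilde{\mathfrak{m}}$ is defined in the same way from $\tilde A,\tilde\pi$. $S_\pi$ and $S_{\tilde\pi}$ are affinely equivalent if there is a bijective affine map $\mathcal{A}:\mathfrak{m}\to\tilde{\mathfrak{m}}$ with $\mathcal{A}(S_\pi)=S_{\tilde\pi}$; such a map is called an affine equivalence. Its linear part is $u\mapsto\mathcal{A}(u)-\mathcal{A}(0)$. Here $\mathfrak{m}$ and $\tilde{\mathfrak{m}}$ are regarded as (non-unital)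 commutative associative algebras. *)

theory Defs
  imports Complex_Main
begin

section \<open>Ideals of a commutative ring\<close>

text \<open>Ideals are the submodules of the ring, seen as a module over itself.\<close>

definition ring_ideal :: "'a::comm_ring_1 set \<Rightarrow> bool" where
  "ring_ideal I \<longleftrightarrow> module.subspace (*) I"

definition maximal_ideal :: "'a::comm_ring_1 set \<Rightarrow> bool" where
  "maximal_ideal M \<longleftrightarrow>
     ring_ideal M \<and> M \<noteq> UNIV \<and> (\<forall>J. ring_ideal J \<and> M \<subseteq> J \<longrightarrow> J = M \<or> J = UNIV)"

primrec ideal_power :: "'a::comm_ring_1 set \<Rightarrow> nat \<Rightarrow> 'a set" where
  "ideal_power I 0 = UNIV"
| "ideal_power I (Suc n) = module.span (*) {x * y |x y. x \<in> I \<and> y \<in> ideal_power I n}"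

text \<open>The annihilator of \<open>M\<close> is taken inside \<open>M\<close>.\<close>

definition annihilator :: "'a::comm_ring_1 set \<Rightarrow> 'a set" where
  "annihilator M = {u \<in> M. \<forall>v\<in>M. u * v = 0}"


section \<open>Gorenstein algebras\<close>

text \<open>The ring structure of an algebra is that of the type; the scalar multiplication is explicit.\<close>

locale comm_algebra = vector_space scale
  for scale :: "'k::field \<Rightarrow> 'a::comm_ring_1 \<Rightarrow> 'a" (infixr \<open>*s\<close> 75) +
  assumes scale_mult_left: "(c *s x) * y = c *s (x * y)"

text \<open>Note that \<open>dim\<close> is \<open>0\<close> for infinite-dimensional spaces.\<close>

locale gorenstein_algebra = comm_algebra scale
  for scale :: "'k::field \<Rightarrow> 'a::comm_ring_1 \<Rightarrow> 'a" (infixr \<open>*s\<close> 75) and M :: "'a set" +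
  assumes finite_dimensional: "\<exists>B. finite B \<and> span B = UNIV"
    and dim_gt_1: "dim (UNIV :: 'a set) > 1"
    and local: "{I. maximal_ideal I} = {M}"
    and dim_annihilator: "dim (annihilator M) = 1"
begin

definition admissible_projection :: "('a \<Rightarrow> 'a) \<Rightarrow> bool" where
  "admissible_projection \<pi> \<longleftrightarrow>
     Vector_Spaces.linear scale scale \<pi> \<and> \<pi> \<circ> \<pi> = \<pi> \<and> range \<pi> = annihilator M \<and> \<pi> 1 = 0"

definition nil_index :: nat where
  "nil_index = (GREATEST \<mu>. ideal_power M \<mu> \<noteq> {0})"

text \<open>The logarithm \<open>1 + M \<rightarrow> M\<close>; it is only meaningful on \<open>1 + M\<close>.\<close>

definition alg_log :: "'a \<Rightarrow> 'a" where
  "alg_log a = (\<Sum>m = 1..nil_index. ((-1) ^ (m + 1) / of_nat m) *s (a - 1) ^ m)"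

definition Q' :: "('a \<Rightarrow> 'a) \<Rightarrow> 'a set" where
  "Q' \<pi> = {a. (\<exists>u\<in>M. a = 1 + u) \<and> \<pi> (a ^ 2) = 0}"

definition hypersurface :: "('a \<Rightarrow> 'a) \<Rightarrow> 'a set" where
  "hypersurface \<pi> = {2 * alg_log a |a. a \<in> Q' \<pi>}"

end


section \<open>Isomorphisms and affine equivalence\<close>

definition linear_on_subspace ::
  "('k::field \<Rightarrow> 'a::comm_ring_1 \<Rightarrow> 'a) \<Rightarrow> 'a set \<Rightarrow>
   ('k \<Rightarrow> 'b::comm_ring_1 \<Rightarrow> 'b) \<Rightarrow> 'b set \<Rightarrow> ('a \<Rightarrow> 'b) \<Rightarrow> bool" where
  "linear_on_subspace sA V sB W L \<longleftrightarrow>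
     L ` V \<subseteq> W \<and>
     (\<forall>x\<in>V. \<forall>y\<in>V. L (x + y) = L x + L y) \<and>
     (\<forall>c. \<forall>x\<in>V. L (sA c x) = sB c (L x))"

text \<open>Isomorphisms of algebras that need not be unital; \<open>V\<close> and \<open>W\<close> are meant to be
  subspaces closed under multiplication. Values outside \<open>V\<close> are irrelevant.\<close>

definition algebra_iso_on ::
  "('k::field \<Rightarrow> 'a::comm_ring_1 \<Rightarrow> 'a) \<Rightarrow> 'a set \<Rightarrow>
   ('k \<Rightarrow> 'b::comm_ring_1 \<Rightarrow> 'b) \<Rightarrow> 'b set \<Rightarrow> ('a \<Rightarrow> 'b) \<Rightarrow> bool" where
  "algebra_iso_on sA V sB W \<phi> \<longleftrightarrow>
     linear_on_subspace sA V sB W \<phi> \<and> bij_betw \<phi> V W \<and>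
     (\<forall>x\<in>V. \<forall>y\<in>V. \<phi> (x * y) = \<phi> x * \<phi> y)"

definition algebras_isomorphic ::
  "('k::field \<Rightarrow> 'a::comm_ring_1 \<Rightarrow> 'a) \<Rightarrow> ('k \<Rightarrow> 'b::comm_ring_1 \<Rightarrow> 'b) \<Rightarrow> bool" where
  "algebras_isomorphic sA sB \<longleftrightarrow> (\<exists>\<phi>. algebra_iso_on sA UNIV sB UNIV \<phi> \<and> \<phi> 1 = 1)"

definition affine_on_subspace ::
  "('k::field \<Rightarrow> 'a::comm_ring_1 \<Rightarrow> 'a) \<Rightarrow> 'a set \<Rightarrow>
   ('k \<Rightarrow> 'b::comm_ring_1 \<Rightarrow> 'b) \<Rightarrow> 'b set \<Rightarrow> ('a \<Rightarrow> 'b) \<Rightarrow> bool" where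
  "affine_on_subspace sA V sB W f \<longleftrightarrow>
     (\<exists>L b. linear_on_subspace sA V sB W L \<and> b \<in> W \<and> (\<forall>x\<in>V. f x = L x + b))"

definition linear_part :: "('a::comm_ring_1 \<Rightarrow> 'b::comm_ring_1) \<Rightarrow> 'a \<Rightarrow> 'b" where
  "linear_part f = (\<lambda>u. f u - f 0)"

text \<open>\<open>f\<close> is an affine equivalence between \<open>S \<subseteq> V\<close> and \<open>T \<subseteq> W\<close>.\<close>

definition affine_equivalence ::
  "('k::field \<Rightarrow> 'a::comm_ring_1 \<Rightarrow> 'a) \<Rightarrow> 'a set \<Rightarrow> 'a set \<Rightarrow>
   ('k \<Rightarrow> 'b::comm_ring_1 \<Rightarrow> 'b) \<Rightarrow> 'b set \<Rightarrow> 'b set \<Rightarrow> ('a \<Rightarrow> 'b) \<Rightarrow> bool" where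
  "affine_equivalence sA V S sB W T f \<longleftrightarrow>
     affine_on_subspace sA V sB W f \<and> bij_betw f V W \<and> f ` S = T"

definition affinely_equivalent ::
  "('k::field \<Rightarrow> 'a::comm_ring_1 \<Rightarrow> 'a) \<Rightarrow> 'a set \<Rightarrow> 'a set \<Rightarrow>
   ('k \<Rightarrow> 'b::comm_ring_1 \<Rightarrow> 'b) \<Rightarrow> 'b set \<Rightarrow> 'b set \<Rightarrow> bool" where
  "affinely_equivalent sA V S sB W T \<longleftrightarrow> (\<exists>f. affine_equivalence sA V S sB W T f)"

end

theory Submission
  imports
    Defs
    "HOL-Computational_Algebra.Formal_Power_Series"
    "HOL-Computational_Algebra.Polynomial"
begin

text \<open>
  Write \<open>\<pi> x = \<theta> x *s \<omega>\<close> for a generator \<open>\<omega>\<close> of the annihilator of \<open>M\<close>. The hypersurface is then the zero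
  set of \<open>\<theta> (exp u)\<close> on \<open>M\<close>, and the form \<open>\<theta> (x * y)\<close> is nondegenerate.

  If the algebras are isomorphic, one may compare two functionals \<open>\<theta>\<close> and \<open>\<theta>'\<close> on the same algebra.
  By nondegeneracy \<open>\<theta>' x = \<theta> (c * x)\<close> with a unit \<open>c = k *s exp w\<close>, so the two hypersurfaces differ by
  the translation by \<open>w\<close>.

  Conversely, let \<open>f u = L u + b\<close> be an affine equivalence. Every line in the direction of the
  annihilator meets the hypersurface in exactly one point, whereas for any other direction some line
  meets it at least twice; hence \<open>L\<close> preserves the annihilators, and \<open>\<theta>B (exp (f u)) = c * \<theta>A (exp u)\<close>
  for a constant \<open>c\<close>. After absorbing \<open>exp b\<close> and \<open>c\<close> into \<open>\<theta>B\<close>, comparison of the coefficients of \<open>t\<close>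
  at \<open>t *s u\<close> gives \<open>\<theta>B ((L u) ^ m) = \<theta>A (u ^ m)\<close>. Polarizing for \<open>m = 2, 3\<close> yields
  \<open>\<theta>B (L (u * v) * L w) = \<theta>A (u * v * w) = \<theta>B (L u * L v * L w)\<close>, so \<open>L\<close> is multiplicative by
  nondegeneracy.
\<close>

unbundle fps_syntax

section \<open>Preliminaries\<close>

lemma unit_cancel_0:
  fixes x y :: "'a::comm_ring_1"
  assumes "x dvd 1" "x * y = 0"
  shows "y = 0"
proof -
  obtain z where "1 = x * z" using assms(1) by blast
  then have "y = x * z * y" by simp
  also have "\<dots> = z * (x * y)" by (simp add: mult_ac)
  finally show ?thesis using assms(2) by simp
qed

section \<open>Ideals and ideal powers in a commutative ring\<close>

lemma module_times: "module ((*) :: 'a::comm_ring_1 \<Rightarrow> 'a \<Rightarrow> 'a)"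
  by unfold_locales (simp_all add: algebra_simps)

lemma vector_space_times: "vector_space ((*) :: 'k::field \<Rightarrow> 'k \<Rightarrow> 'k)"
  by unfold_locales (simp_all add: algebra_simps)

lemma ring_ideal_iff:
  "ring_ideal I \<longleftrightarrow> 0 \<in> I \<and> (\<forall>x\<in>I. \<forall>y\<in>I. x + y \<in> I) \<and> (\<forall>c. \<forall>x\<in>I. c * x \<in> I)"
  by (simp add: ring_ideal_def module.subspace_def[OF module_times])

lemma ring_ideal_range_times: "ring_ideal (range ((*) x))"
proof -
  have "0 \<in> range ((*) x)"
    by (rule range_eqI[of _ _ 0]) simp
  moreover have "x * a + x * b \<in> range ((*) x)" "c * (x * a) \<in> range ((*) x)" for a b c
    by (rule range_eqI[of _ _ "a + b"] range_eqI[of _ _ "c * a"], simp add: algebra_simps)+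
  ultimately show ?thesis
    by (auto simp: ring_ideal_iff)
qed

lemma times_mem_ideal_power_Suc:
  "x \<in> I \<Longrightarrow> y \<in> ideal_power I n \<Longrightarrow> x * y \<in> ideal_power I (Suc n)"
  by (auto intro!: module.span_base[OF module_times])

lemma power_mem_ideal_power: "x \<in> I \<Longrightarrow> x ^ n \<in> ideal_power I n"
  by (induction n) (auto simp del: ideal_power.simps(2) intro: times_mem_ideal_power_Suc)

lemma power_mult_power_mem_ideal_power:
  "x \<in> I \<Longrightarrow> y \<in> I \<Longrightarrow> x ^ m * y ^ n \<in> ideal_power I (m + n)"
  by (induction m)
    (auto simp: mult.assoc power_mem_ideal_power simp del: ideal_power.simps(2)
      intro: times_mem_ideal_power_Suc)

lemma ideal_power_zero_add: "ideal_power I n = {0} \<Longrightarrow> ideal_power I (n + k) = {0}"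
proof (induction k)
  case (Suc k)
  have "ideal_power I (Suc (n + k)) \<subseteq> {0}"
    unfolding ideal_power.simps
    by (rule module.span_minimal[OF module_times])
      (auto simp: Suc module.subspace_def[OF module_times])
  moreover have "0 \<in> ideal_power I (Suc (n + k))"
    by (simp add: module.span_zero[OF module_times])
  ultimately show ?case by (simp del: ideal_power.simps) blast
qed simp

section \<open>Rearranged sums, polarization and comparison of coefficients\<close>

lemma sum_square_eq_sum_triangle:
  fixes F :: "nat \<Rightarrow> nat \<Rightarrow> 'a::comm_monoid_add"
  assumes "\<And>i j. n < i + j \<Longrightarrow> F i j = 0"
  shows "(\<Sum>i\<le>n. \<Sum>j\<le>n. F i j) = (\<Sum>k\<le>n. \<Sum>i\<le>k. F i (k - i))"
proof -
  have "(\<Sum>i\<le>n. \<Sum>j\<le>n. F i j) = (\<Sum>(i, j)\<in>{..n} \<times> {..n}. F i j)"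
    by (simp add: sum.cartesian_product)
  also have "\<dots> = (\<Sum>(i, j)\<in>{(i, j). i + j \<le> n}. F i j)"
    by (rule sum.mono_neutral_right) (auto intro: assms)
  finally show ?thesis by (simp add: sum.triangle_reindex_eq)
qed

lemma polarize_square:
  fixes x y :: "'a::comm_ring_1"
  shows "(x + y) ^ 2 - x ^ 2 - y ^ 2 = of_nat 2 * (x * y)"
  by (simp add: power2_eq_square algebra_simps)

text \<open>Inclusion-exclusion over the nonempty subsets of the three variables leaves only the
  monomials in which all of them occur.\<close>

lemma polarize_cube:
  fixes x y z :: "'a::comm_ring_1"
  shows "(x + y + z) ^ 3 - (x + y) ^ 3 - (x + z) ^ 3 - (y + z) ^ 3 + x ^ 3 + y ^ 3 + z ^ 3 =
    of_nat 6 * (x * y * z)"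
  by (simp add: power3_eq_cube algebra_simps)

text \<open>The scalar field is infinite, so a polynomial that vanishes at every scalar is
  zero.\<close>

lemma sum_powers_eq_imp_coeffs_eq:
  fixes a b :: "nat \<Rightarrow> 'k::field_char_0"
  assumes "\<And>t. (\<Sum>i\<le>n. t ^ i * a i) = (\<Sum>i\<le>n. t ^ i * b i)" "i \<le> n"
  shows "a i = b i"
proof -
  define p where "p = (\<Sum>i\<le>n. monom (a i - b i) i)"
  have "poly p t = 0" for t
    using assms(1)[of t]
    by (simp add: p_def poly_sum poly_monom right_diff_distrib sum_subtractf mult.commute[of _ "t ^ _"])
  then have "p = 0" by (simp add: poly_all_0_iff_0[symmetric])
  moreover have "coeff p i = a i - b i"
    using assms(2) by (simp add: p_def coeff_sum sum.delta)
  ultimately show ?thesis by simp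
qed

lemma linear_diff:
  assumes "Vector_Spaces.linear s t f"
  shows "f (x - y) = f x - f y"
proof -
  interpret Vector_Spaces.linear s t f by fact
  show ?thesis by (rule diff)
qed

lemma linear_sum:
  assumes "Vector_Spaces.linear s t f"
  shows "f (\<Sum>i\<in>I. g i) = (\<Sum>i\<in>I. f (g i))"
proof -
  interpret Vector_Spaces.linear s t f by fact
  show ?thesis by (rule sum)
qed

lemma linear_add: "Vector_Spaces.linear s t f \<Longrightarrow> f (x + y) = f x + f y"
  and linear_scale: "Vector_Spaces.linear s t f \<Longrightarrow> f (s c x) = t c (f x)"
  by (simp_all add: Vector_Spaces.linear_iff)

lemma linear_0: "Vector_Spaces.linear s t f \<Longrightarrow> f 0 = 0"
  using linear_diff[of s t f 0 0] by simp

context comm_algebra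
begin

lemma scale_conv_mult: "c *s x = (c *s 1) * x"
  by (simp add: scale_mult_left)

lemma scale_mult_right: "x * (c *s y) = c *s (x * y)"
  by (metis mult.commute scale_mult_left)

lemma scale_mult_scale: "(c *s x) * (d *s y) = (c * d) *s (x * y)"
  by (simp add: scale_mult_left scale_mult_right)

lemma power_scale: "(c *s x) ^ n = (c ^ n) *s (x ^ n)"
  by (induction n) (simp_all add: scale_mult_scale)

lemma of_nat_mult_eq_scale: "of_nat n * x = of_nat n *s x"
  by (induction n) (simp_all add: distrib_right scale_left_distrib)

lemma subspace_ring_ideal: "ring_ideal I \<Longrightarrow> subspace I"
  unfolding subspace_def ring_ideal_iff by (metis scale_conv_mult)

end

section \<open>Structure of Gorenstein algebras\<close>

context gorenstein_algebra
begin

section \<open>Finite dimensionality and nonunits\<close>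

definition basis :: "'a set" where
  "basis = (SOME B. finite B \<and> independent B \<and> span B = UNIV)"

lemma basis: "finite basis \<and> independent basis \<and> span basis = UNIV"
proof -
  obtain C where C: "finite C" "span C = UNIV"
    using finite_dimensional by blast
  obtain B where "B \<subseteq> C" "independent B" "C \<subseteq> span B"
    by (rule maximal_independent_subset[of C])
  with C have "finite B \<and> independent B \<and> span B = UNIV"
    by (metis finite_subset span_mono span_span top.extremum_uniqueI)
  then show ?thesis
    unfolding basis_def by (rule someI)
qed

text \<open>The chosen basis gives access to the dimension arguments of linear algebra: strict
  inclusions raise the dimension, and injective endomorphisms are surjective.\<close>

sublocale finite_dimensional_vector_space scale basis
  using basis by unfold_locales auto

lemma maximal_ideal_M: "maximal_ideal M"
  using local by blast

lemma ring_ideal_M: "ring_ideal M"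
  using maximal_ideal_M by (simp add: maximal_ideal_def)

lemma subspace_M: "subspace M"
  by (simp add: ring_ideal_M subspace_ring_ideal)

lemma M_closed [simp, intro]:
  "0 \<in> M" "x \<in> M \<Longrightarrow> y \<in> M \<Longrightarrow> x + y \<in> M" "x \<in> M \<Longrightarrow> y \<in> M \<Longrightarrow> x - y \<in> M"
  "x \<in> M \<Longrightarrow> - x \<in> M" "x \<in> M \<Longrightarrow> c *s x \<in> M"
  using subspace_M subspace_0 subspace_add subspace_diff subspace_neg subspace_scale by auto

lemma mult_mem_M [simp, intro]: "x \<in> M \<Longrightarrow> y * x \<in> M" "x \<in> M \<Longrightarrow> x * y \<in> M"
  using ring_ideal_M by (auto simp: ring_ideal_iff mult.commute[of x])

lemma unit_not_mem_M: "x dvd 1 \<Longrightarrow> x \<notin> M"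
proof
  assume "x dvd 1" "x \<in> M"
  then obtain y where "1 = x * y" by blast
  with \<open>x \<in> M\<close> have "1 \<in> M" by (metis mult_mem_M(2))
  then have "z \<in> M" for z
    using mult_mem_M(1)[of 1 z] by simp
  then show False
    using maximal_ideal_M by (auto simp: maximal_ideal_def)
qed

text \<open>A nonunit \<open>x\<close> generates a proper ideal. Among the proper ideals containing
  \<open>x\<close>, one of largest dimension is maximal, hence equal to \<open>M\<close> by
  locality.\<close>

lemma mem_M_iff: "x \<in> M \<longleftrightarrow> \<not> x dvd 1"
proof
  assume nd: "\<not> x dvd 1"
  define P where "P J \<longleftrightarrow> ring_ideal J \<and> J \<noteq> UNIV \<and> x \<in> J" for J
  have "P (range ((*) x))"
    using nd ring_ideal_range_times[of x] unfolding P_def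
    by (metis UNIV_I dvdI mult.right_neutral rangeE rangeI)
  moreover have "\<forall>J. P J \<longrightarrow> dim J < Suc dimension"
    using dim_subset_UNIV by (simp add: less_Suc_eq_le)
  ultimately obtain J where J: "P J" and max: "\<And>I. P I \<Longrightarrow> dim I \<le> dim J"
    using ex_has_greatest_nat[of P _ dim] by blast
  have "maximal_ideal J"
    unfolding maximal_ideal_def
  proof (intro conjI allI impI)
    fix I assume I: "ring_ideal I \<and> J \<subseteq> I"
    show "I = J \<or> I = UNIV"
    proof (rule ccontr)
      assume *: "\<not> (I = J \<or> I = UNIV)"
      with I J have "P I" by (auto simp: P_def)
      with max have "dim I \<le> dim J" by blast
      then have "J = I"
        using I J by (intro subspace_dim_equal) (auto simp: P_def subspace_ring_ideal)
      with * show False by simp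
    qed
  qed (use J in \<open>auto simp: P_def\<close>)
  then have "J = M" using local by blast
  with J show "x \<in> M" by (simp add: P_def)
qed (use unit_not_mem_M in blast)

lemma one_not_mem_M: "1 \<notin> M"
  by (simp add: mem_M_iff)

lemma unit_add_M: "u \<in> M \<Longrightarrow> (1 + u) dvd 1"
proof (rule ccontr)
  assume u: "u \<in> M" and "\<not> (1 + u) dvd 1"
  then have "1 + u - u \<in> M"
    using mem_M_iff subspace_M subspace_diff by blast
  then show False using one_not_mem_M by simp
qed

text \<open>Among the multiples \<open>z * x\<close> outside \<open>K\<close> one generating an ideal of least dimension works:
  for \<open>u \<in> M\<close> the ideal generated by \<open>z * x * u\<close> is strictly smaller.\<close>

lemma exists_multiple_in_socle_modulo:
  assumes "0 \<in> K" "z \<notin> K"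
  shows "\<exists>x. z * x \<notin> K \<and> (\<forall>u\<in>M. z * x * u \<in> K)"
proof -
  have "z * 1 \<notin> K" using assms by simp
  then obtain x where x: "z * x \<notin> K"
    and min: "\<And>y. z * y \<notin> K \<Longrightarrow> dim (range ((*) (z * x))) \<le> dim (range ((*) (z * y)))"
    using ex_has_least_nat[of "\<lambda>x. z * x \<notin> K" 1 "\<lambda>x. dim (range ((*) (z * x)))"] by blast
  have "z * x * u \<in> K" if u: "u \<in> M" for u
  proof (rule ccontr)
    assume "z * x * u \<notin> K"
    then have "dim (range ((*) (z * x))) \<le> dim (range ((*) (z * x * u)))"
      using min[of "x * u"] by (simp add: mult.assoc)
    moreover have "range ((*) (z * x * u)) \<subseteq> range ((*) (z * x))"
      by (auto simp: mult.assoc)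
    ultimately have "range ((*) (z * x * u)) = range ((*) (z * x))"
      by (intro subspace_dim_equal subspace_ring_ideal ring_ideal_range_times)
    \<comment> \<open>Equality of the ideals writes \<open>z * x\<close> as
      \<open>z * x * u * a\<close>, and \<open>1 - u * a\<close> is a unit since it lies in
      \<open>1 + M\<close>.\<close>
    then obtain a where "z * x * 1 = z * x * u * a"
      by (metis rangeE rangeI)
    then have "z * x * (1 + u * (- a)) = 0" by (simp add: algebra_simps)
    moreover have "(1 + u * (- a)) dvd 1"
      using u by (intro unit_add_M mult_mem_M)
    ultimately have "z * x = 0"
      using unit_cancel_0 by (metis mult.commute)
    with x assms show False by simp
  qed
  with x show ?thesis by blast
qed

section \<open>The annihilator of the maximal ideal and the residue field\<close>

lemma M_nontrivial: "\<exists>u\<in>M. u \<noteq> 0"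
proof (rule ccontr)
  assume "\<not> ?thesis"
  then have "annihilator M \<subseteq> {0}" by (auto simp: annihilator_def)
  then have "dim (annihilator M) \<le> dim {0}" by (rule dim_subset)
  then show False using dim_annihilator by simp
qed

text \<open>This is the preceding socle argument with \<open>K = {0}\<close>. It says that every
  nonzero ideal meets the annihilator, which is the source of nondegeneracy below.\<close>

lemma exists_multiple_in_annihilator:
  assumes "z \<noteq> 0"
  shows "\<exists>x. z * x \<noteq> 0 \<and> z * x \<in> annihilator M"
proof -
  obtain x where x: "z * x \<noteq> 0" and ann: "\<forall>u\<in>M. z * x * u = 0"
    using exists_multiple_in_socle_modulo[of "{0}" z] assms by auto
  \<comment> \<open>A unit that kills \<open>M\<close> would force \<open>M\<close> to be
    zero.\<close>
  have "z * x \<in> M"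
  proof (rule ccontr)
    assume "z * x \<notin> M"
    then have "z * x dvd 1" using mem_M_iff by blast
    then have "u = 0" if "u \<in> M" for u
      using that ann unit_cancel_0 by blast
    then show False using M_nontrivial by blast
  qed
  with x ann show ?thesis by (auto simp: annihilator_def)
qed

lemma annihilator_eq_span: "\<exists>\<omega>. \<omega> \<noteq> 0 \<and> annihilator M = range (\<lambda>c. c *s \<omega>)"
proof -
  have sub: "subspace (annihilator M)"
    using subspace_M
    by (auto simp: annihilator_def subspace_def distrib_right scale_mult_left)
  obtain B where B: "B \<subseteq> annihilator M" "independent B" "annihilator M \<subseteq> span B"
      "card B = dim (annihilator M)"
    by (rule basis_exists)
  then obtain \<omega> where \<omega>: "B = {\<omega>}"
    using dim_annihilator by (auto simp: card_1_singleton_iff)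
  have "span B = annihilator M"
    using B sub by (meson span_minimal subset_antisym)
  moreover have "\<omega> \<noteq> 0"
    using B \<omega> by (metis dependent_zero insertI1)
  ultimately show ?thesis using \<omega> by (metis span_singleton)
qed

text \<open>Since the annihilator is a line, \<open>x\<close> acts on it as a scalar
  \<open>k\<close>. Then \<open>x - k *s 1\<close> kills a nonzero element, so it is a nonunit and
  lies in \<open>M\<close>. In particular the residue field is the scalar field itself.\<close>

lemma scalar_plus_M: "\<exists>k. \<exists>u\<in>M. x = k *s 1 + u"
proof -
  obtain \<omega> where \<omega>: "\<omega> \<noteq> 0" "annihilator M = range (\<lambda>c. c *s \<omega>)"
    using annihilator_eq_span by blast
  have "\<omega> = 1 *s \<omega>" by simp
  then have "\<omega> \<in> annihilator M" using \<omega>(2) by blast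
  then have "x * \<omega> \<in> annihilator M"
    by (auto simp: annihilator_def mult.assoc)
  then obtain k where k: "x * \<omega> = k *s \<omega>" using \<omega> by blast
  then have "(x - k *s 1) * \<omega> = 0"
    by (simp add: left_diff_distrib scale_mult_left)
  then have "\<not> (x - k *s 1) dvd 1"
    using \<omega>(1) by (auto simp: unit_cancel_0)
  then have "x - k *s 1 \<in> M" by (simp add: mem_M_iff)
  then show ?thesis by (intro exI[of _ k] bexI[of _ "x - k *s 1"]) auto
qed

text \<open>The annihilators of the powers of \<open>M\<close> grow strictly until they exhaust the algebra.\<close>

lemma ideal_power_M_eventually_zero: "\<exists>k. ideal_power M k = {0}"
proof (rule ccontr)
  assume nz: "\<not> ?thesis"
  define K where "K k = {x. \<forall>y\<in>ideal_power M k. x * y = 0}" for k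
  have sub: "subspace (K k)" for k
    by (rule subspace_ring_ideal) (simp add: K_def ring_ideal_iff algebra_simps)
  have one: "1 \<notin> K k" for k
  proof
    assume "1 \<in> K k"
    then have "ideal_power M k \<subseteq> {0}" by (auto simp: K_def)
    moreover have "0 \<in> ideal_power M k"
      by (cases k) (auto simp: module.span_zero[OF module_times])
    ultimately show False using nz by blast
  qed
  have psub: "K k \<subset> K (Suc k)" for k
  proof -
    have "0 \<in> K k" by (simp add: K_def)
    then obtain x where x: "x \<notin> K k" and xM: "\<forall>u\<in>M. x * u \<in> K k"
      using exists_multiple_in_socle_modulo[of "K k" 1] one[of k] by auto
    \<comment> \<open>Such a \<open>w\<close> kills all the products that span the next power of
      \<open>M\<close>.\<close>
    have "w \<in> K (Suc k)" if w: "\<forall>u\<in>M. w * u \<in> K k" for w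
    proof -
      have "ideal_power M (Suc k) \<subseteq> {y. w * y = 0}"
        unfolding ideal_power.simps using w
        by (intro module.span_minimal[OF module_times])
          (auto simp: K_def module.subspace_def[OF module_times] algebra_simps)
      then show ?thesis by (auto simp: K_def)
    qed
    moreover have "\<forall>u\<in>M. w * u \<in> K k" if "w \<in> K k" for w
      using that by (auto simp: K_def mult.commute mult.left_commute)
    ultimately show ?thesis using x xM by blast
  qed
  have "k \<le> dim (K k)" for k
  proof (induction k)
    case (Suc k)
    have "dim (K k) < dim (K (Suc k))"
      by (rule dim_psubset) (use psub sub in \<open>simp add: span_eq_iff[THEN iffD2]\<close>)
    with Suc show ?case by simp
  qed simp
  then show False
    using dim_subset_UNIV[of "K (Suc dimension)"] by (metis not_less_eq_eq le_trans)
qed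

text \<open>Some power vanishes and all later ones with it. This bounds the exponents in the
  definition of \<open>nil_index\<close>, so that \<open>GREATEST\<close> yields a true
  maximum.\<close>

lemma ideal_power_M_zero: "nil_index < n \<Longrightarrow> ideal_power M n = {0}"
proof (rule ccontr)
  assume n: "nil_index < n" "ideal_power M n \<noteq> {0}"
  obtain k where "ideal_power M k = {0}" using ideal_power_M_eventually_zero by blast
  then have "\<forall>\<mu>. ideal_power M \<mu> \<noteq> {0} \<longrightarrow> \<mu> \<le> k"
    by (metis ideal_power_zero_add le_add_diff_inverse nle_le)
  then have "n \<le> nil_index"
    unfolding nil_index_def using n(2) by (intro Greatest_le_nat) auto
  with n show False by simp
qed

lemma power_mult_power_eq_0:
  "u \<in> M \<Longrightarrow> v \<in> M \<Longrightarrow> nil_index < m + n \<Longrightarrow> u ^ m * v ^ n = 0"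
  using power_mult_power_mem_ideal_power ideal_power_M_zero by blast

lemma power_eq_0: "u \<in> M \<Longrightarrow> nil_index < n \<Longrightarrow> u ^ n = 0"
  using power_mult_power_eq_0[of u u n 0] by simp

text \<open>The reduction map modulo \<open>M\<close>, with values in the scalars. The description
  is unique because \<open>M\<close> contains no nonzero multiple of 1.\<close>

definition residue :: "'a \<Rightarrow> 'k" where
  "residue x = (THE k. x - k *s 1 \<in> M)"

lemma scale_one_mem_M_iff: "k *s 1 \<in> M \<longleftrightarrow> k = 0"
proof
  assume *: "k *s 1 \<in> M"
  show "k = 0"
  proof (rule ccontr)
    assume "k \<noteq> 0"
    then have "1 = inverse k *s (k *s 1)" by simp
    then have "1 \<in> M" using * by (metis M_closed(5))
    then show False using one_not_mem_M by simp
  qed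
qed simp

lemma residue_eqI:
  assumes "x - k *s 1 \<in> M"
  shows "residue x = k"
  unfolding residue_def
proof (rule the_equality)
  fix l assume "x - l *s 1 \<in> M"
  with assms have "(x - k *s 1) - (x - l *s 1) \<in> M" by (rule M_closed)
  then have "(l - k) *s 1 \<in> M" by (simp add: scale_left_diff_distrib)
  then show "l = k" by (simp add: scale_one_mem_M_iff)
qed fact

lemma residue_eq: "u \<in> M \<Longrightarrow> residue (k *s 1 + u) = k"
  by (simp add: residue_eqI)

subsection \<open>Functionals that do not vanish on the annihilator\<close>

text \<open>Such a functional generates the dual space as a module over the algebra (see
  \<open>dual_generator_represents\<close>), and \<open>\<theta> (x * y)\<close> is a Frobenius
  form.\<close>

definition dual_generator :: "('a \<Rightarrow> 'k) \<Rightarrow> bool" where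
  "dual_generator \<theta> \<longleftrightarrow>
     Vector_Spaces.linear scale (*) \<theta> \<and> (\<forall>x\<in>annihilator M. \<theta> x = 0 \<longrightarrow> x = 0)"

lemma linear_functionalI:
  assumes "\<And>x y. \<theta> (x + y) = \<theta> x + \<theta> y" "\<And>c x. \<theta> (c *s x) = c * \<theta> x"
  shows "Vector_Spaces.linear scale (*) \<theta>"
  using assms vector_space_axioms vector_space_times by (simp add: Vector_Spaces.linear_iff)

lemma annihilator_memD:
  "a \<in> annihilator M \<Longrightarrow> a \<in> M" "a \<in> annihilator M \<Longrightarrow> u \<in> M \<Longrightarrow> a * u = 0"
  by (auto simp: annihilator_def)

lemma scale_mem_annihilator: "a \<in> annihilator M \<Longrightarrow> c *s a \<in> annihilator M"
  by (auto simp: annihilator_def scale_mult_left)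

text \<open>The coordinate of \<open>\<pi>\<close> along a generator of the annihilator serves as
  \<open>\<theta>\<close>. As \<open>\<pi>\<close> fixes its range pointwise, this coordinate
  vanishes on the annihilator only at 0.\<close>

lemma admissible_projection_dual_generator:
  assumes "admissible_projection \<pi>"
  obtains \<theta> where "dual_generator \<theta>" "\<And>x. \<pi> x = 0 \<longleftrightarrow> \<theta> x = 0"
proof -
  have lin: "Vector_Spaces.linear scale scale \<pi>" and idem: "\<And>x. \<pi> (\<pi> x) = \<pi> x"
    and ran: "range \<pi> = annihilator M"
    using assms by (auto simp: admissible_projection_def fun_eq_iff)
  obtain \<omega> where \<omega>: "\<omega> \<noteq> 0" "annihilator M = range (\<lambda>c. c *s \<omega>)"
    using annihilator_eq_span by blast
  define \<theta> where "\<theta> x = (THE c. \<pi> x = c *s \<omega>)" for x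
  have eqI: "\<theta> x = c" if "\<pi> x = c *s \<omega>" for x c
    unfolding \<theta>_def using that \<omega>(1) by (intro the_equality) auto
  have \<pi>: "\<pi> x = \<theta> x *s \<omega>" for x
  proof -
    obtain c where "\<pi> x = c *s \<omega>" using ran \<omega>(2) by blast
    with eqI[OF this] show ?thesis by simp
  qed
  have zero: "\<pi> x = 0 \<longleftrightarrow> \<theta> x = 0" for x
    using \<pi> \<omega>(1) by simp
  have "Vector_Spaces.linear scale (*) \<theta>"
    by (intro linear_functionalI eqI)
      (simp_all add: linear_add[OF lin] linear_scale[OF lin] scale_left_distrib
        flip: \<pi> scale_scale)
  moreover have "x = 0" if "x \<in> annihilator M" "\<theta> x = 0" for x
  proof -
    have "x \<in> range \<pi>" using that(1) ran by simp
    then have "\<pi> x = x" using idem by auto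
    with that(2) zero[of x] show ?thesis by simp
  qed
  ultimately show ?thesis
    using that zero by (auto simp: dual_generator_def)
qed

text \<open>A nonzero \<open>z\<close> has a nonzero multiple in the annihilator, where
  \<open>\<theta>\<close> cannot vanish.\<close>

lemma dual_generator_nondegenerate:
  assumes "dual_generator \<theta>" "\<And>x. \<theta> (z * x) = 0"
  shows "z = 0"
  using exists_multiple_in_annihilator[of z] assms by (auto simp: dual_generator_def)

text \<open>Nondegeneracy makes the map from \<open>c\<close> to the functional
  \<open>\<theta> (c * x)\<close> injective, and the algebra and its dual have the same finite
  dimension.\<close>

lemma dual_generator_represents:
  assumes gen: "dual_generator \<theta>" and \<mu>: "Vector_Spaces.linear scale (*) \<mu>"
  obtains c where "\<And>x. \<mu> x = \<theta> (c * x)"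
proof -
  have \<theta>: "Vector_Spaces.linear scale (*) \<theta>"
    using gen by (simp add: dual_generator_def)
  \<comment> \<open>A functional is encoded by its values on the basis, taken as coordinates. This
    replaces the map into the dual space by an endomorphism of the algebra.\<close>
  define T where "T c = (\<Sum>b\<in>basis. \<theta> (c * b) *s b)" for c
  have T: "Vector_Spaces.linear scale scale T"
    by (simp add: Vector_Spaces.linear_iff vector_space_axioms T_def distrib_right linear_add[OF \<theta>]
        scale_mult_left linear_scale[OF \<theta>] scale_left_distrib sum.distrib scale_sum_right)
  have coeff: "x b = y b" if "(\<Sum>b\<in>basis. x b *s b) = (\<Sum>b\<in>basis. y b *s b)" "b \<in> basis" for x y b
    using independentD[of basis basis "\<lambda>b. x b - y b" b] basis that
    by (simp add: scale_left_diff_distrib sum_subtractf)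
  have ext: "\<nu> x = \<nu>' x"
    if "Vector_Spaces.linear scale (*) \<nu>" "Vector_Spaces.linear scale (*) \<nu>'"
      and "\<And>b. b \<in> basis \<Longrightarrow> \<nu> b = \<nu>' b" for \<nu> \<nu>' :: "'a \<Rightarrow> 'k" and x
  proof -
    have "basis \<subseteq> {x. \<nu> x = \<nu>' x}" using that(3) by blast
    moreover have "subspace {x. \<nu> x = \<nu>' x}"
      using that(1,2) by (auto simp: subspace_def linear_add linear_scale linear_0)
    ultimately have "span basis \<subseteq> {x. \<nu> x = \<nu>' x}" by (rule span_minimal)
    then show ?thesis using basis by auto
  qed
  have mult: "Vector_Spaces.linear scale (*) (\<lambda>x. \<theta> (c * x))" for c
    by (intro linear_functionalI)
      (simp_all add: distrib_left linear_add[OF \<theta>] scale_mult_right linear_scale[OF \<theta>])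
  have "inj T"
  proof (rule injI)
    fix c d assume "T c = T d"
    then have "\<theta> (c * b) = \<theta> (d * b)" if "b \<in> basis" for b
      using coeff[of "\<lambda>b. \<theta> (c * b)" "\<lambda>b. \<theta> (d * b)"] that by (simp add: T_def)
    then have "\<theta> (c * x) = \<theta> (d * x)" for x
      using ext[OF mult[of c] mult[of d]] by blast
    then have "\<theta> ((c - d) * x) = 0" for x
      by (simp add: left_diff_distrib linear_diff[OF \<theta>])
    then show "c = d"
      using dual_generator_nondegenerate[OF gen, of "c - d"] by simp
  qed
  then obtain c where "T c = (\<Sum>b\<in>basis. \<mu> b *s b)"
    using linear_inj_imp_surj[OF T] by (metis surjD)
  then have "\<mu> b = \<theta> (c * b)" if "b \<in> basis" for b
    using coeff[of \<mu> "\<lambda>b. \<theta> (c * b)" b] that by (simp add: T_def)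
  then have "\<mu> x = \<theta> (c * x)" for x
    using ext[OF \<mu> mult] by blast
  then show ?thesis by (rule that)
qed

subsection \<open>Evaluation of power series on the maximal ideal\<close>

text \<open>The terms cut off vanish on \<open>M\<close>. Evaluation at an element of
  \<open>M\<close> therefore respects products, and identities between formal power series carry
  over to the algebra.\<close>

definition fps_eval :: "'k fps \<Rightarrow> 'a \<Rightarrow> 'a" where
  "fps_eval f u = (\<Sum>m\<le>nil_index. (f $ m) *s u ^ m)"

lemma fps_eval_eq_sum:
  assumes "u \<in> M" "nil_index \<le> n"
  shows "fps_eval f u = (\<Sum>m\<le>n. (f $ m) *s u ^ m)"
  unfolding fps_eval_def
  by (rule sum.mono_neutral_left) (use assms in \<open>auto simp: power_eq_0\<close>)

lemma fps_eval_diff: "fps_eval (f - g) u = fps_eval f u - fps_eval g u"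
  by (simp add: fps_eval_def scale_left_diff_distrib sum_subtractf)

lemma fps_eval_const [simp]: "fps_eval (fps_const c) u = c *s 1"
proof -
  have "fps_eval (fps_const c) u = (\<Sum>m\<le>nil_index. if m = 0 then c *s 1 else 0)"
    unfolding fps_eval_def by (intro sum.cong) auto
  then show ?thesis by simp
qed

lemma fps_eval_1 [simp]: "fps_eval 1 u = 1"
  using fps_eval_const[of 1 u] by simp

lemma fps_eval_X [simp]:
  assumes "u \<in> M"
  shows "fps_eval fps_X u = u"
proof -
  \<comment> \<open>The range is lengthened by one so that it contains the index 1 whatever
    \<open>nil_index\<close> is.\<close>
  have "fps_eval fps_X u = (\<Sum>m\<le>Suc nil_index. (fps_X $ m) *s u ^ m)"
    using assms by (intro fps_eval_eq_sum) auto
  also have "\<dots> = (\<Sum>m\<le>Suc nil_index. if m = 1 then u else 0)"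
    by (intro sum.cong) auto
  finally show ?thesis by simp
qed

lemma fps_eval_mult:
  assumes "u \<in> M"
  shows "fps_eval (f * g) u = fps_eval f u * fps_eval g u"
proof -
  define F where "F i j = (f $ i * g $ j) *s u ^ (i + j)" for i j
  have "fps_eval f u * fps_eval g u = (\<Sum>i\<le>nil_index. \<Sum>j\<le>nil_index. F i j)"
    by (simp add: fps_eval_def sum_product scale_mult_scale power_add F_def)
  also have "\<dots> = (\<Sum>k\<le>nil_index. \<Sum>i\<le>k. F i (k - i))"
    by (rule sum_square_eq_sum_triangle) (simp add: F_def power_eq_0 assms)
  also have "\<dots> = fps_eval (f * g) u"
    by (simp add: fps_eval_def fps_mult_nth scale_sum_left F_def atLeast0AtMost)
  finally show ?thesis by simp
qed

lemma fps_eval_power: "u \<in> M \<Longrightarrow> fps_eval (f ^ n) u = fps_eval f u ^ n"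
  by (induction n) (simp_all add: fps_eval_mult)

lemma fps_eval_mem_M:
  assumes "u \<in> M" "f $ 0 = 0"
  shows "fps_eval f u \<in> M"
  unfolding fps_eval_def
proof (rule subspace_sum[OF subspace_M])
  fix m
  show "(f $ m) *s u ^ m \<in> M"
    using assms by (cases m) auto
qed

lemma fps_eval_compose:
  assumes "u \<in> M" "g $ 0 = 0"
  shows "fps_eval (f oo g) u = fps_eval f (fps_eval g u)"
proof -
  have "fps_eval (f oo g) u =
      (\<Sum>n\<le>nil_index. \<Sum>i\<le>n. (f $ i * (g ^ i) $ n) *s u ^ n)"
    by (simp add: fps_eval_def fps_compose_nth scale_sum_left atLeast0AtMost)
  \<comment> \<open>The power \<open>g ^ i\<close> has no terms below degree \<open>i\<close>, so
    the added summands are zero and the two sums can be exchanged.\<close>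
  also have "\<dots> = (\<Sum>n\<le>nil_index. \<Sum>i\<le>nil_index. (f $ i * (g ^ i) $ n) *s u ^ n)"
    by (intro sum.cong sum.mono_neutral_left)
      (auto simp: startsby_zero_power_prefix[OF assms(2)])
  also have "\<dots> = (\<Sum>i\<le>nil_index. (f $ i) *s (\<Sum>n\<le>nil_index. ((g ^ i) $ n) *s u ^ n))"
    by (subst sum.swap) (simp add: scale_sum_right)
  also have "\<dots> = (\<Sum>i\<le>nil_index. (f $ i) *s fps_eval g u ^ i)"
    using assms(1) by (simp add: fps_eval_def[of "g ^ _", symmetric] fps_eval_power)
  also have "\<dots> = fps_eval f (fps_eval g u)"
    by (simp add: fps_eval_def[of f])
  finally show ?thesis .
qed

end

section \<open>The exponential map and the hypersurface\<close>

locale gorenstein_algebra_char_0 = gorenstein_algebra scale M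
  for scale :: "'k::field_char_0 \<Rightarrow> 'a::comm_ring_1 \<Rightarrow> 'a" (infixr \<open>*s\<close> 75) and M :: "'a set"
begin

section \<open>Exponential and logarithm as mutually inverse maps\<close>

definition alg_exp :: "'a \<Rightarrow> 'a" where
  "alg_exp = fps_eval (fps_exp 1)"

text \<open>The binomial theorem handles the two variables. Products \<open>u ^ i * v ^ j\<close> of
  total degree above \<open>nil_index\<close> vanish, so the square of indices reduces to a
  triangle.\<close>

lemma alg_exp_add:
  assumes "u \<in> M" "v \<in> M"
  shows "alg_exp (u + v) = alg_exp u * alg_exp v"
proof -
  define F where "F i j = (1 / (fact i * fact j) :: 'k) *s (u ^ i * v ^ j)" for i j
  have "alg_exp u * alg_exp v = (\<Sum>i\<le>nil_index. \<Sum>j\<le>nil_index. F i j)"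
    by (simp add: alg_exp_def fps_eval_def sum_product scale_mult_scale F_def)
  also have "\<dots> = (\<Sum>k\<le>nil_index. \<Sum>i\<le>k. F i (k - i))"
    by (rule sum_square_eq_sum_triangle) (simp add: F_def power_mult_power_eq_0 assms)
  also have "\<dots> = alg_exp (u + v)"
    unfolding alg_exp_def fps_eval_def
  proof (rule sum.cong[OF refl])
    fix k
    have "(fps_exp 1 $ k) *s (u + v) ^ k
        = (\<Sum>i\<le>k. (1 / fact k * of_nat (k choose i) :: 'k) *s (u ^ i * v ^ (k - i)))"
      by (simp add: binomial_ring scale_sum_right of_nat_mult_eq_scale mult.assoc scale_mult_left)
    also have "\<dots> = (\<Sum>i\<le>k. F i (k - i))"
      by (intro sum.cong) (auto simp: F_def binomial_fact)
    finally show "(\<Sum>i\<le>k. F i (k - i)) = (fps_exp 1 $ k) *s (u + v) ^ k" by simp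
  qed
  finally show ?thesis by simp
qed

lemma alg_exp_minus_1_mem_M: "u \<in> M \<Longrightarrow> alg_exp u - 1 \<in> M"
  using fps_eval_mem_M[of u "fps_exp 1 - 1"] by (simp add: alg_exp_def fps_eval_diff)

lemma alg_log_eq_fps_eval: "alg_log a = fps_eval (fps_ln 1) (a - 1)"
proof -
  have "(\<Sum>m\<le>nil_index. (fps_ln 1 $ m) *s (a - 1) ^ m)
      = (\<Sum>m=1..nil_index. (fps_ln 1 $ m) *s (a - 1) ^ m)"
    by (rule sum.mono_neutral_right) (auto simp: not_le)
  also have "\<dots> = alg_log a"
    unfolding alg_log_def
  proof (rule sum.cong[OF refl])
    fix m assume "m \<in> {1..nil_index}"
    then obtain l where "m = Suc l" by (cases m) auto
    then show "(fps_ln 1 $ m) *s (a - 1) ^ m = ((- 1) ^ (m + 1) / of_nat m) *s (a - 1) ^ m"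
      by (simp add: fps_ln_nth)
  qed
  finally show ?thesis by (simp add: fps_eval_def)
qed

lemma alg_log_mem_M: "a - 1 \<in> M \<Longrightarrow> alg_log a \<in> M"
  by (simp add: alg_log_eq_fps_eval fps_eval_mem_M)

text \<open>The series \<open>fps_ln 1\<close> and \<open>fps_exp 1 - 1\<close> are inverse under
  composition. Subtracting 1 removes the constant term of the exponential, and evaluation transports
  the identity.\<close>

lemma alg_exp_log:
  assumes "a - 1 \<in> M"
  shows "alg_exp (alg_log a) = a"
proof -
  have "alg_exp (alg_log a) - 1 = fps_eval (fps_exp 1 - 1) (fps_eval (fps_ln 1) (a - 1))"
    by (simp add: alg_exp_def alg_log_eq_fps_eval fps_eval_diff)
  also have "\<dots> = fps_eval ((fps_exp 1 - 1) oo fps_ln 1) (a - 1)"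
    using assms by (simp add: fps_eval_compose)
  also have "\<dots> = a - 1"
    using assms by (simp add: fps_ln_fps_exp_inv fps_inv_fps_exp_compose)
  finally show ?thesis by simp
qed

lemma alg_log_exp:
  assumes "u \<in> M"
  shows "alg_log (alg_exp u) = u"
proof -
  have "alg_log (alg_exp u) = fps_eval (fps_ln 1) (fps_eval (fps_exp 1 - 1) u)"
    by (simp add: alg_exp_def alg_log_eq_fps_eval fps_eval_diff)
  also have "\<dots> = fps_eval (fps_ln 1 oo (fps_exp 1 - 1)) u"
    using assms by (simp add: fps_eval_compose)
  also have "\<dots> = u"
    using assms by (simp add: fps_ln_fps_exp_inv fps_inv_fps_exp_compose)
  finally show ?thesis .
qed

text \<open>Doubling the logarithm of \<open>a\<close> corresponds to squaring \<open>a\<close>: for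
  \<open>u = 2 * alg_log a\<close> one has \<open>alg_exp u = a ^ 2\<close>. Conversely
  \<open>a\<close> is the exponential of half of \<open>u\<close>.\<close>

lemma hypersurface_eq: "hypersurface \<pi> = {u \<in> M. \<pi> (alg_exp u) = 0}"
proof (intro equalityI subsetI)
  fix x assume "x \<in> hypersurface \<pi>"
  then obtain a where "a \<in> Q' \<pi>" and x: "x = 2 * alg_log a"
    unfolding hypersurface_def by blast
  then have a: "a - 1 \<in> M" "\<pi> (a ^ 2) = 0"
    by (auto simp: Q'_def)
  have "x = alg_log a + alg_log a"
    by (simp only: x mult_2)
  moreover have l: "alg_log a \<in> M"
    using a(1) by (rule alg_log_mem_M)
  ultimately have "x \<in> M" "alg_exp x = a ^ 2"
    using alg_exp_add[OF l l] a(1) by (simp_all only: alg_exp_log power2_eq_square M_closed)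
  with a(2) show "x \<in> {u \<in> M. \<pi> (alg_exp u) = 0}" by simp
next
  fix u assume "u \<in> {u \<in> M. \<pi> (alg_exp u) = 0}"
  then have u: "u \<in> M" "\<pi> (alg_exp u) = 0" by auto
  define v where "v = (1 / 2) *s u"
  have v: "v \<in> M" "v + v = u"
    using u by (auto simp: v_def simp flip: scale_left_distrib)
  then have "alg_exp v ^ 2 = alg_exp u"
    using alg_exp_add[of v v] by (simp add: power2_eq_square)
  with u v have "alg_exp v \<in> Q' \<pi>"
    using alg_exp_minus_1_mem_M[of v] by (auto simp: Q'_def intro!: bexI[of _ "alg_exp v - 1"])
  moreover have "u = 2 * alg_log (alg_exp v)"
    using v(2) by (simp only: alg_log_exp[OF v(1)] mult_2)
  ultimately show "u \<in> hypersurface \<pi>"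
    unfolding hypersurface_def by blast
qed

section \<open>Lines meeting the hypersurface\<close>

lemma alg_exp_annihilator:
  assumes "a \<in> annihilator M"
  shows "alg_exp a = 1 + a"
proof -
  have a: "a \<in> M" "a ^ Suc (Suc n) = 0" for n
    using annihilator_memD(1)[OF assms] annihilator_memD(2)[OF assms] by (simp_all flip: mult.assoc)
  \<comment> \<open>The range is lengthened to contain degree 1 for certain; all higher terms vanish
    because \<open>a\<close> squares to zero.\<close>
  have "alg_exp a = (\<Sum>m\<le>Suc nil_index. (fps_exp 1 $ m) *s a ^ m)"
    unfolding alg_exp_def using a(1) by (rule fps_eval_eq_sum) simp
  also have "\<dots> = (\<Sum>m\<le>1. (fps_exp 1 $ m) *s a ^ m)"
  proof (rule sum.mono_neutral_right)
    show "\<forall>m\<in>{..Suc nil_index} - {..1}. (fps_exp 1 $ m) *s a ^ m = 0"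
    proof
      fix m assume "m \<in> {..Suc nil_index} - {..1}"
      then obtain n where "m = Suc (Suc n)"
        by (cases m; cases "m - 1") auto
      with a show "(fps_exp 1 $ m) *s a ^ m = 0" by simp
    qed
  qed auto
  finally show ?thesis by simp
qed

text \<open>Elements of \<open>1 + M\<close> act as the identity on the annihilator. Hence a dual
  generator composed with \<open>alg_exp\<close> is affine with nonzero slope along lines in the
  direction of a nonzero \<open>a\<close>.\<close>

lemma alg_exp_add_annihilator:
  assumes "u \<in> M" "a \<in> annihilator M"
  shows "alg_exp (u + a) = alg_exp u + a"
proof -
  have "a * (alg_exp u - 1) = 0"
    using assms alg_exp_minus_1_mem_M annihilator_memD(2) by blast
  then have "alg_exp u * a = a"
    by (simp add: algebra_simps)
  then show ?thesis
    using assms by (simp add: alg_exp_add annihilator_memD alg_exp_annihilator distrib_left)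
qed

text \<open>For \<open>a = alg_exp v - 1\<close> in the annihilator,
  \<open>alg_exp a = 1 + a = alg_exp v\<close>, and injectivity of \<open>alg_exp\<close> gives
  \<open>a = v\<close>.\<close>

lemma alg_exp_minus_1_mem_annihilator:
  assumes "v \<in> M" "alg_exp v - 1 \<in> annihilator M"
  shows "v \<in> annihilator M"
proof -
  have "alg_exp (alg_exp v - 1) = alg_exp v"
    using alg_exp_annihilator[OF assms(2)] by simp
  then have "alg_exp v - 1 = v"
    using assms annihilator_memD(1) alg_log_exp by metis
  with assms show ?thesis by simp
qed

text \<open>Together with \<open>alg_exp_add_annihilator\<close>, this characterizes the directions in the annihilator
  by the way lines in this direction meet the hypersurface.\<close>

lemma exists_parallel_secant:
  assumes gen: "dual_generator \<theta>" and v: "v \<in> M" "v \<notin> annihilator M"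
  obtains u where "u \<in> M" "\<theta> (alg_exp u) = 0" "\<theta> (alg_exp (u + v)) = 0"
proof -
  have \<theta>: "Vector_Spaces.linear scale (*) \<theta>"
    using gen by (simp add: dual_generator_def)
  \<comment> \<open>With \<open>alg_exp u = 1 + x\<close> one has
    \<open>alg_exp (u + v) = (1 + x) * (1 + w)\<close>. It suffices to find \<open>x\<close> in
    \<open>M\<close> with \<open>\<theta> x = - \<theta> 1\<close> and
    \<open>\<theta> (x * w) = - \<theta> w\<close>.\<close>
  define w where "w = alg_exp v - 1"
  have w: "w \<in> M" "w \<notin> annihilator M"
    using v alg_exp_minus_1_mem_M alg_exp_minus_1_mem_annihilator by (auto simp: w_def)
  then obtain y where y: "y \<in> M" "w * y \<noteq> 0"
    by (auto simp: annihilator_def)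
  then obtain z where z: "\<theta> (w * y * z) \<noteq> 0"
    using dual_generator_nondegenerate[OF gen, of "w * y"] by blast
  \<comment> \<open>The factor \<open>y\<close> keeps \<open>p\<close> inside \<open>M\<close>; the
    scalar normalizes \<open>\<theta> (p * w)\<close> to 1.\<close>
  define p where "p = (1 / \<theta> (w * y * z)) *s (y * z)"
  have p: "p \<in> M" "\<theta> (p * w) = 1"
    using y z by (auto simp: p_def scale_mult_left scale_mult_right linear_scale[OF \<theta>] mult_ac)
  obtain q0 where q0: "q0 \<in> annihilator M" "q0 \<noteq> 0"
    using annihilator_eq_span by (metis rangeI scale_one)
  then have "\<theta> q0 \<noteq> 0" using gen by (auto simp: dual_generator_def)
  define q where "q = (1 / \<theta> q0) *s q0"
  have q: "q \<in> M" "q * w = 0" "\<theta> q = 1"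
    using q0 \<open>\<theta> q0 \<noteq> 0\<close> w annihilator_memD[of q0]
    by (auto simp: q_def linear_scale[OF \<theta>] scale_mult_left)
  \<comment> \<open>The two conditions form a triangular system: \<open>p\<close> settles the value
    of \<open>\<theta> (x * w)\<close>, and \<open>q\<close> then corrects \<open>\<theta> x\<close>
    without disturbing it, as \<open>q * w = 0\<close>.\<close>
  define x where "x = (- \<theta> w) *s p + (\<theta> w * \<theta> p - \<theta> 1) *s q"
  have x: "x \<in> M" "\<theta> x = - \<theta> 1" "\<theta> (x * w) = - \<theta> w"
    using p q by (simp_all add: x_def linear_add[OF \<theta>] linear_scale[OF \<theta>] linear_diff[OF \<theta>]
        linear_0[OF \<theta>] distrib_right scale_mult_left left_diff_distrib del: scale_minus_left)
  define u where "u = alg_log (1 + x)"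
  have u: "u \<in> M" "alg_exp u = 1 + x"
    using x(1) by (simp_all add: u_def alg_log_mem_M alg_exp_log)
  have "\<theta> (alg_exp u) = 0"
    using x by (simp add: u linear_add[OF \<theta>])
  moreover have "alg_exp (u + v) = alg_exp u + (w + x * w)"
    using u v by (simp add: alg_exp_add w_def algebra_simps)
  ultimately have "\<theta> (alg_exp (u + v)) = 0"
    using x by (simp add: linear_add[OF \<theta>])
  with u \<open>\<theta> (alg_exp u) = 0\<close> show ?thesis by (intro that)
qed

lemma alg_exp_scale_power_series:
  assumes "u \<in> M" "nil_index \<le> n"
  shows "alg_exp (t *s u) = (\<Sum>m\<le>n. (t ^ m / fact m) *s u ^ m)"
  using assms by (simp add: alg_exp_def fps_eval_eq_sum[of _ n] power_scale)

end

section \<open>Isomorphisms and affine equivalences\<close>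

locale gorenstein_algebra_pair =
  A: gorenstein_algebra_char_0 sA mA + B: gorenstein_algebra_char_0 sB mB
  for sA :: "'k::field_char_0 \<Rightarrow> 'a::comm_ring_1 \<Rightarrow> 'a" and mA :: "'a set"
    and sB :: "'k \<Rightarrow> 'b::comm_ring_1 \<Rightarrow> 'b" and mB :: "'b set"
begin

section \<open>Extending isomorphisms from the maximal ideals\<close>

definition extend_unital :: "('a \<Rightarrow> 'b) \<Rightarrow> 'a \<Rightarrow> 'b" where
  "extend_unital L x = sB (A.residue x) 1 + L (x - sA (A.residue x) 1)"

text \<open>Each algebra is the direct sum of the scalars and its maximal ideal, so \<open>L\<close>
  extends by sending 1 to 1. Expanding a product of two such sums leaves only scalar multiples and
  products in \<open>mA\<close>, which \<open>L\<close> respects.\<close>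

lemma algebras_isomorphic_if_iso_on_maximal_ideals:
  assumes "algebra_iso_on sA mA sB mB L"
  shows "algebras_isomorphic sA sB"
proof -
  have L: "\<And>x. x \<in> mA \<Longrightarrow> L x \<in> mB" "bij_betw L mA mB"
    "\<And>x y. x \<in> mA \<Longrightarrow> y \<in> mA \<Longrightarrow> L (x + y) = L x + L y"
    "\<And>c x. x \<in> mA \<Longrightarrow> L (sA c x) = sB c (L x)"
    "\<And>x y. x \<in> mA \<Longrightarrow> y \<in> mA \<Longrightarrow> L (x * y) = L x * L y"
    using assms by (auto simp: algebra_iso_on_def linear_on_subspace_def)
  let ?f = "extend_unital L"
  have f: "?f (sA k 1 + u) = sB k 1 + L u" if "u \<in> mA" for k u
    using that by (simp add: extend_unital_def A.residue_eq)
  have L0: "L 0 = 0" using L(4)[of 0 0] by simp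
  have "?f 1 = 1"
    using f[of 0 1] L0 by simp
  moreover have "?f (x + y) = ?f x + ?f y" for x y
  proof -
    obtain k u where u: "u \<in> mA" "x = sA k 1 + u" using A.scalar_plus_M by blast
    obtain l v where v: "v \<in> mA" "y = sA l 1 + v" using A.scalar_plus_M by blast
    have "x + y = sA (k + l) 1 + (u + v)"
      using u v by (simp add: A.scale_left_distrib)
    moreover have "?f (sA (k + l) 1 + (u + v)) = sB (k + l) 1 + L (u + v)"
      by (rule f) (use u v in simp)
    ultimately show ?thesis
      using f[OF u(1), of k] f[OF v(1), of l]
      by (simp only: u(2) v(2) L(3)[OF u(1) v(1)] B.scale_left_distrib add_ac)
  qed
  moreover have "?f (sA c x) = sB c (?f x)" for c x
  proof -
    obtain k u where u: "u \<in> mA" "x = sA k 1 + u" using A.scalar_plus_M by blast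
    then have "sA c x = sA (c * k) 1 + sA c u"
      by (simp add: A.scale_right_distrib)
    moreover have "?f (sA (c * k) 1 + sA c u) = sB (c * k) 1 + L (sA c u)"
      by (rule f) (use u in simp)
    ultimately show ?thesis
      using f[OF u(1), of k] by (simp add: u(2) L(4)[OF u(1)] B.scale_right_distrib)
  qed
  moreover have "?f (x * y) = ?f x * ?f y" for x y
  proof -
    obtain k u where u: "u \<in> mA" "x = sA k 1 + u" using A.scalar_plus_M by blast
    obtain l v where v: "v \<in> mA" "y = sA l 1 + v" using A.scalar_plus_M by blast
    have m: "sA k v + sA l u + u * v \<in> mA" using u v by simp
    have xy: "x * y = sA (k * l) 1 + (sA k v + sA l u + u * v)"
      unfolding u(2) v(2) by (simp add: distrib_left distrib_right A.scale_mult_left A.scale_mult_right mult.commute)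
    have "?f (x * y) = sB (k * l) 1 + (sB k (L v) + sB l (L u) + L u * L v)"
      unfolding xy f[OF m] using u(1) v(1) by (simp add: L)
    also have "\<dots> = (sB k 1 + L u) * (sB l 1 + L v)"
      by (simp add: distrib_left distrib_right B.scale_mult_left B.scale_mult_right mult.commute)
    finally show ?thesis by (simp only: u(2) v(2) f[OF u(1)] f[OF v(1)])
  qed
  moreover have "bij ?f"
  proof (rule bijI)
    show "inj ?f"
    proof (rule injI)
      fix x y assume eq: "?f x = ?f y"
      obtain k u where u: "u \<in> mA" "x = sA k 1 + u" using A.scalar_plus_M by blast
      obtain l v where v: "v \<in> mA" "y = sA l 1 + v" using A.scalar_plus_M by blast
      have eq': "sB k 1 + L u = sB l 1 + L v" using eq u v f by simp
      then have "k = l" using B.residue_eq[of "L u" k] B.residue_eq[of "L v" l] u v L(1) by simp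
      with eq' u v L(2) show "x = y" by (auto simp: bij_betw_def dest: inj_onD)
    qed
    show "surj ?f"
      unfolding surj_def
    proof
      fix y
      obtain k v where v: "v \<in> mB" "y = sB k 1 + v" using B.scalar_plus_M by blast
      then obtain u where "u \<in> mA" "v = L u" using L(2) by (auto simp: bij_betw_def)
      then have "y = ?f (sA k 1 + u)" using v f by simp
      then show "\<exists>x. y = ?f x" by blast
    qed
  qed
  ultimately show ?thesis
    unfolding algebras_isomorphic_def algebra_iso_on_def linear_on_subspace_def by blast
qed

section \<open>From isomorphisms to affine equivalences\<close>

lemma alg_exp_commute_hom:
  assumes "\<phi> 1 = 1" "\<And>x y. \<phi> (x * y) = \<phi> x * \<phi> y" "\<And>x y. \<phi> (x + y) = \<phi> x + \<phi> y"
    and "\<And>c x. \<phi> (sA c x) = sB c (\<phi> x)" "u \<in> mA" "\<phi> u \<in> mB"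
  shows "\<phi> (A.alg_exp u) = B.alg_exp (\<phi> u)"
proof -
  \<comment> \<open>Each exponential is cut off at the index of its own algebra; a common bound
    makes the sums comparable.\<close>
  define n where "n = max A.nil_index B.nil_index"
  have [simp]: "\<phi> (x ^ m) = \<phi> x ^ m" for x m
    by (induction m) (simp_all add: assms)
  have "\<phi> 0 = 0" using assms(3)[of 0 0] by simp
  then have [simp]: "\<phi> (\<Sum>i\<in>I. g i) = (\<Sum>i\<in>I. \<phi> (g i))" for g and I :: "nat set"
    by (induction I rule: infinite_finite_induct) (simp_all add: assms)
  have "A.nil_index \<le> n" "B.nil_index \<le> n" by (simp_all add: n_def)
  with assms show ?thesis
    by (simp add: A.alg_exp_def B.alg_exp_def A.fps_eval_eq_sum[of _ n] B.fps_eval_eq_sum[of _ n])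
qed

lemma affinely_equivalent_if_isomorphic:
  assumes "algebras_isomorphic sA sB"
    and genA: "A.dual_generator \<theta>A" and genB: "B.dual_generator \<theta>B"
  shows "affinely_equivalent sA mA {u \<in> mA. \<theta>A (A.alg_exp u) = 0}
           sB mB {u \<in> mB. \<theta>B (B.alg_exp u) = 0}"
proof -
  obtain \<phi> where \<phi>: "\<phi> 1 = 1" "bij \<phi>" "\<And>x y. \<phi> (x * y) = \<phi> x * \<phi> y"
      "\<And>x y. \<phi> (x + y) = \<phi> x + \<phi> y" "\<And>c x. \<phi> (sA c x) = sB c (\<phi> x)"
    using assms(1) unfolding algebras_isomorphic_def algebra_iso_on_def linear_on_subspace_def
    by auto
  have \<theta>A: "Vector_Spaces.linear sA (*) \<theta>A" and \<theta>B: "Vector_Spaces.linear sB (*) \<theta>B"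
    using genA genB by (auto simp: A.dual_generator_def B.dual_generator_def)
  have \<phi>0: "\<phi> 0 = 0" using \<phi>(5)[of 0 0] by simp
  have \<phi>_diff: "\<phi> (x - y) = \<phi> x - \<phi> y" for x y
    using \<phi>(4)[of "x - y" y] by simp
  have inj: "\<phi> x = \<phi> y \<longleftrightarrow> x = y" for x y
    using \<phi>(2) by (auto simp: bij_def dest: injD)
  \<comment> \<open>The maximal ideals are the sets of nonunits, so preserving units in both
    directions matches them.\<close>
  have dvd: "\<phi> x dvd 1 \<longleftrightarrow> x dvd 1" for x
  proof
    assume "\<phi> x dvd 1"
    then obtain y where "1 = \<phi> x * y" by blast
    moreover obtain z where "y = \<phi> z" using \<phi>(2) by (metis bij_pointE)
    ultimately have "\<phi> 1 = \<phi> (x * z)" using \<phi> by simp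
    then have "1 = x * z" by (simp only: inj)
    then show "x dvd 1" by (rule dvdI)
  next
    assume "x dvd 1"
    then obtain y where "1 = x * y" by blast
    then have "1 = \<phi> x * \<phi> y" using \<phi>(1,3) by metis
    then show "\<phi> x dvd 1" by (rule dvdI)
  qed
  have mem: "\<phi> x \<in> mB \<longleftrightarrow> x \<in> mA" for x
    by (simp add: A.mem_M_iff B.mem_M_iff dvd)
  have surj: "\<exists>x\<in>mA. y = \<phi> x" if "y \<in> mB" for y
    using that mem \<phi>(2) by (metis bij_pointE)
  have "Vector_Spaces.linear sA (*) (\<lambda>x. \<theta>B (\<phi> x))"
    by (intro A.linear_functionalI) (simp_all add: \<phi> linear_add[OF \<theta>B] linear_scale[OF \<theta>B])
  then obtain c where c: "\<And>x. \<theta>B (\<phi> x) = \<theta>A (c * x)"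
    using A.dual_generator_represents[OF genA] by metis
  obtain k u where u: "u \<in> mA" "c = sA k 1 + u" using A.scalar_plus_M by blast
  \<comment> \<open>Otherwise \<open>c\<close> lies in \<open>mA\<close> and kills the annihilator.
    Then \<open>\<theta>B\<close> would vanish on its image, which lies in the annihilator of
    \<open>mB\<close>.\<close>
  have "k \<noteq> 0"
  proof
    assume "k = 0"
    obtain a where a: "a \<noteq> 0" "a \<in> annihilator mA"
      using A.annihilator_eq_span by (metis A.scale_one rangeI)
    with \<open>k = 0\<close> u have "\<theta>B (\<phi> a) = 0"
      using A.annihilator_memD(2)[OF a(2) u(1)] by (simp add: c mult.commute linear_0[OF \<theta>A])
    moreover have "\<phi> a * v = 0" if v: "v \<in> mB" for v
    proof -
      obtain w where "w \<in> mA" "v = \<phi> w" using surj[OF v] by blast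
      then show ?thesis using A.annihilator_memD(2)[OF a(2)] \<phi>(3) \<phi>0 by metis
    qed
    then have "\<phi> a \<in> annihilator mB"
      using A.annihilator_memD(1)[OF a(2)] by (auto simp: annihilator_def mem)
    ultimately have "\<phi> a = \<phi> 0" using genB by (simp add: B.dual_generator_def \<phi>0)
    then show False using a inj by blast
  qed
  \<comment> \<open>Dividing \<open>c\<close> by \<open>k\<close> puts it into \<open>1 + M\<close>,
    where the logarithm applies.\<close>
  define w where "w = A.alg_log (1 + sA (1 / k) u)"
  have w: "w \<in> mA" "c = sA k (A.alg_exp w)"
    using u \<open>k \<noteq> 0\<close>
    by (simp_all add: w_def A.alg_log_mem_M A.alg_exp_log A.scale_right_distrib)
  \<comment> \<open>Multiplication by \<open>c\<close> turns \<open>alg_exp (v - w)\<close> into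
    \<open>k\<close> times \<open>alg_exp v\<close>, which explains the translation by
    \<open>- \<phi> w\<close>.\<close>
  have key: "\<theta>B (B.alg_exp (\<phi> v - \<phi> w)) = k * \<theta>A (A.alg_exp v)" if v: "v \<in> mA" for v
  proof -
    have d: "v - w \<in> mA" using v w by simp
    have "B.alg_exp (\<phi> v - \<phi> w) = \<phi> (A.alg_exp (v - w))"
      using \<phi> d by (simp add: alg_exp_commute_hom mem flip: \<phi>_diff)
    then have "\<theta>B (B.alg_exp (\<phi> v - \<phi> w)) = k * \<theta>A (A.alg_exp w * A.alg_exp (v - w))"
      using w by (simp add: c A.scale_mult_left linear_scale[OF \<theta>A])
    also have "A.alg_exp w * A.alg_exp (v - w) = A.alg_exp v"
      using A.alg_exp_add[OF w(1) d] by simp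
    finally show ?thesis .
  qed
  define f where "f v = \<phi> v - \<phi> w" for v
  have "affine_equivalence sA mA {u \<in> mA. \<theta>A (A.alg_exp u) = 0}
      sB mB {u \<in> mB. \<theta>B (B.alg_exp u) = 0} f"
    unfolding affine_equivalence_def
  proof (intro conjI)
    have "linear_on_subspace sA mA sB mB \<phi>"
      using \<phi> mem by (auto simp: linear_on_subspace_def)
    then show "affine_on_subspace sA mA sB mB f"
      unfolding affine_on_subspace_def using w mem
      by (intro exI[of _ \<phi>] exI[of _ "- \<phi> w"]) (auto simp: f_def)
    have f_surj: "\<exists>x\<in>mA. y = f x" if "y \<in> mB" for y
    proof -
      have "y + \<phi> w \<in> mB" using that w mem by simp
      then show ?thesis using surj by (metis f_def add_diff_cancel_right')
    qed
    have f_mem: "f x \<in> mB" if "x \<in> mA" for x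
      using that w mem by (simp add: f_def)
    then show "bij_betw f mA mB"
      using f_surj by (auto simp: bij_betw_def inj_on_def f_def inj)
    show "f ` {u \<in> mA. \<theta>A (A.alg_exp u) = 0} = {u \<in> mB. \<theta>B (B.alg_exp u) = 0}"
    proof (intro equalityI subsetI)
      fix y assume "y \<in> f ` {u \<in> mA. \<theta>A (A.alg_exp u) = 0}"
      then show "y \<in> {u \<in> mB. \<theta>B (B.alg_exp u) = 0}"
        using f_mem key by (auto simp: f_def)
    next
      fix y assume y: "y \<in> {u \<in> mB. \<theta>B (B.alg_exp u) = 0}"
      then obtain x where "x \<in> mA" "y = f x" using f_surj by auto
      with y key \<open>k \<noteq> 0\<close> show "y \<in> f ` {u \<in> mA. \<theta>A (A.alg_exp u) = 0}"
        by (auto simp: f_def)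
    qed
  qed
  then show ?thesis by (auto simp: affinely_equivalent_def)
qed

section \<open>From affine equivalences to isomorphisms\<close>

lemma alg_exp_intertwining_imp_mult:
  assumes L: "linear_on_subspace sA mA sB mB L" and L_surj: "L ` mA = mB"
    and \<theta>A: "Vector_Spaces.linear sA (*) \<theta>A" and genB: "B.dual_generator \<theta>B"
    and eq: "\<And>u. u \<in> mA \<Longrightarrow> \<theta>B (B.alg_exp (L u)) = \<theta>A (A.alg_exp u)"
    and uv: "u \<in> mA" "v \<in> mA"
  shows "L (u * v) = L u * L v"
proof -
  have L_mem: "\<And>x. x \<in> mA \<Longrightarrow> L x \<in> mB"
    and L_add: "\<And>x y. x \<in> mA \<Longrightarrow> y \<in> mA \<Longrightarrow> L (x + y) = L x + L y"
    and L_scale: "\<And>c x. x \<in> mA \<Longrightarrow> L (sA c x) = sB c (L x)"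
    using L by (auto simp: linear_on_subspace_def)
  have \<theta>B: "Vector_Spaces.linear sB (*) \<theta>B"
    using genB by (simp add: B.dual_generator_def)
  have pow: "\<theta>B (L x ^ m) = \<theta>A (x ^ m)" if x: "x \<in> mA" for x m
  proof -
    \<comment> \<open>Including \<open>m\<close> in the bound provides a coefficient of
      \<open>t ^ m\<close> even beyond both nilpotency indices.\<close>
    define n where "n = max m (max A.nil_index B.nil_index)"
    have n: "m \<le> n" "A.nil_index \<le> n" "B.nil_index \<le> n" by (auto simp: n_def)
    have "(\<Sum>i\<le>n. t ^ i * (\<theta>B (L x ^ i) / fact i)) = (\<Sum>i\<le>n. t ^ i * (\<theta>A (x ^ i) / fact i))" for t
      using eq[of "sA t x"] x n L_mem
      by (simp add: L_scale A.alg_exp_scale_power_series[of _ n] B.alg_exp_scale_power_series[of _ n]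
          linear_sum[OF \<theta>A] linear_sum[OF \<theta>B] linear_scale[OF \<theta>A] linear_scale[OF \<theta>B])
    then have "\<theta>B (L x ^ m) / fact m = \<theta>A (x ^ m) / fact m"
      using n(1) by (rule sum_powers_eq_imp_coeffs_eq)
    then show ?thesis by simp
  qed
  have two: "\<theta>B (L x * L y) = \<theta>A (x * y)" if xy: "x \<in> mA" "y \<in> mA" for x y
  proof -
    have "2 * \<theta>A (x * y) = \<theta>A (of_nat 2 * (x * y))"
      unfolding A.of_nat_mult_eq_scale by (simp add: linear_scale[OF \<theta>A])
    also have "\<dots> = \<theta>B (of_nat 2 * (L x * L y))"
      using pow[of "x + y" 2] xy
      by (simp only: flip: polarize_square)
        (simp add: linear_diff[OF \<theta>A] linear_diff[OF \<theta>B] pow L_add)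
    also have "\<dots> = 2 * \<theta>B (L x * L y)"
      unfolding B.of_nat_mult_eq_scale by (simp add: linear_scale[OF \<theta>B])
    finally show ?thesis by simp
  qed
  have three: "\<theta>B (L x * L y * L z) = \<theta>A (x * y * z)"
    if xyz: "x \<in> mA" "y \<in> mA" "z \<in> mA" for x y z
  proof -
    have "6 * \<theta>A (x * y * z) = \<theta>A (of_nat 6 * (x * y * z))"
      unfolding A.of_nat_mult_eq_scale by (simp add: linear_scale[OF \<theta>A])
    also have "\<dots> = \<theta>B (of_nat 6 * (L x * L y * L z))"
      using pow[of "x + y + z" 3] pow[of "x + y" 3] pow[of "x + z" 3] pow[of "y + z" 3] xyz
      by (simp only: flip: polarize_cube)
        (simp add: linear_diff[OF \<theta>A] linear_diff[OF \<theta>B] linear_add[OF \<theta>A] linear_add[OF \<theta>B] pow L_add)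
    also have "\<dots> = 6 * \<theta>B (L x * L y * L z)"
      unfolding B.of_nat_mult_eq_scale by (simp add: linear_scale[OF \<theta>B])
    finally show ?thesis by simp
  qed
  have uv_mem: "u * v \<in> mA" using uv by simp
  have "\<theta>B ((L (u * v) - L u * L v) * x) = 0" for x
  proof -
    \<comment> \<open>The form is tested on scalars and on \<open>mB\<close> separately:
      \<open>two\<close> and \<open>three\<close> cover the elements of \<open>mB\<close>, while
      \<open>pow\<close> with exponent 1 and \<open>two\<close> cover the scalars.\<close>
    obtain k y where y: "y \<in> mB" "x = sB k 1 + y" using B.scalar_plus_M by blast
    then obtain z where z: "z \<in> mA" "y = L z" using L_surj by blast
    have "\<theta>B (L (u * v) * L z) = \<theta>B (L u * L v * L z)"
      using two[OF uv_mem z(1)] three[OF uv z(1)] by simp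
    moreover have "\<theta>B (L (u * v)) = \<theta>B (L u * L v)"
      using pow[OF uv_mem, of 1] two[OF uv] by simp
    ultimately show ?thesis
      by (simp add: y z distrib_left left_diff_distrib B.scale_mult_right linear_add[OF \<theta>B]
          linear_diff[OF \<theta>B] linear_scale[OF \<theta>B])
  qed
  then have "L (u * v) - L u * L v = 0"
    using B.dual_generator_nondegenerate[OF genB] by blast
  then show ?thesis by simp
qed

lemma linear_part_affine_equivalence_is_iso:
  assumes genA: "A.dual_generator \<theta>A" and genB: "B.dual_generator \<theta>B"
    and f: "affine_equivalence sA mA {u \<in> mA. \<theta>A (A.alg_exp u) = 0}
           sB mB {u \<in> mB. \<theta>B (B.alg_exp u) = 0} f"
  shows "algebra_iso_on sA mA sB mB (linear_part f)"
proof -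
  have \<theta>A: "Vector_Spaces.linear sA (*) \<theta>A" and \<theta>B: "Vector_Spaces.linear sB (*) \<theta>B"
    using genA genB by (auto simp: A.dual_generator_def B.dual_generator_def)
  obtain L0 b where L0: "linear_on_subspace sA mA sB mB L0" and b: "b \<in> mB"
    and f_L0: "\<forall>x\<in>mA. f x = L0 x + b"
    using f unfolding affine_equivalence_def affine_on_subspace_def by blast
  have bij_f: "bij_betw f mA mB"
    and f_image: "f ` {u \<in> mA. \<theta>A (A.alg_exp u) = 0} = {u \<in> mB. \<theta>B (B.alg_exp u) = 0}"
    using f by (auto simp: affine_equivalence_def)
  define L where "L = linear_part f"
  \<comment> \<open>This yields \<open>f 0 = b\<close>, so the linear part of \<open>f\<close>
    agrees with \<open>L0\<close> on \<open>mA\<close>.\<close>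
  have "L0 (sA 0 0) = sB 0 (L0 0)"
    using L0 A.M_closed(1) unfolding linear_on_subspace_def by blast
  then have "L0 0 = 0" by simp
  then have L_L0: "L x = L0 x" if "x \<in> mA" for x
    using that f_L0 by (simp add: L_def linear_part_def)
  have f_L: "f x = L x + b" if "x \<in> mA" for x
    using that f_L0 L_L0 by simp
  have L: "linear_on_subspace sA mA sB mB L"
    using L0 L_L0 by (auto simp: linear_on_subspace_def)
  then have L_mem: "\<And>x. x \<in> mA \<Longrightarrow> L x \<in> mB"
    and L_add: "\<And>x y. x \<in> mA \<Longrightarrow> y \<in> mA \<Longrightarrow> L (x + y) = L x + L y"
    and L_scale: "\<And>c x. x \<in> mA \<Longrightarrow> L (sA c x) = sB c (L x)"
    by (auto simp: linear_on_subspace_def)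
  have f_mem: "f x \<in> mB" if "x \<in> mA" for x
    using that bij_f by (auto simp: bij_betw_def)
  have f_surj: "\<exists>x\<in>mA. y = f x" if "y \<in> mB" for y
    using that bij_f by (auto simp: bij_betw_def)
  have L_bij: "bij_betw L mA mB"
    unfolding bij_betw_def
  proof
    show "inj_on L mA"
      using bij_f f_L by (auto simp: bij_betw_def inj_on_def)
    have "y \<in> L ` mA" if "y \<in> mB" for y
    proof -
      have "y + b \<in> mB" using that b by simp
      then obtain x where "x \<in> mA" "y + b = f x" using f_surj by blast
      then show ?thesis using f_L by force
    qed
    then show "L ` mA = mB" using L_mem by blast
  qed
  have zero_iff: "\<theta>B (B.alg_exp (f x)) = 0 \<longleftrightarrow> \<theta>A (A.alg_exp x) = 0" if x: "x \<in> mA" for x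
  proof
    assume "\<theta>B (B.alg_exp (f x)) = 0"
    then have "f x \<in> f ` {u \<in> mA. \<theta>A (A.alg_exp u) = 0}"
      using f_image f_mem x by simp
    then obtain y where "y \<in> mA" "\<theta>A (A.alg_exp y) = 0" "f x = f y" by auto
    with x bij_f show "\<theta>A (A.alg_exp x) = 0" by (metis bij_betw_def inj_onD)
  next
    assume "\<theta>A (A.alg_exp x) = 0"
    then show "\<theta>B (B.alg_exp (f x)) = 0" using f_image x by blast
  qed
  obtain a where a: "a \<noteq> 0" "a \<in> annihilator mA"
    using A.annihilator_eq_span by (metis A.scale_one rangeI)
  then have \<theta>a: "\<theta>A a \<noteq> 0" using genA by (auto simp: A.dual_generator_def)
  have a_mem: "a \<in> mA" using a A.annihilator_memD(1) by blast
  \<comment> \<open>Otherwise two points of the second hypersurface differ by \<open>L a\<close>.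
    Their preimages differ by \<open>a\<close> and both lie on the first one, although
    \<open>\<theta>A\<close> of the exponential changes by \<open>\<theta>A a\<close> between
    them.\<close>
  have La: "L a \<in> annihilator mB"
  proof (rule ccontr)
    assume "L a \<notin> annihilator mB"
    then obtain x where x: "x \<in> mB" "\<theta>B (B.alg_exp x) = 0" "\<theta>B (B.alg_exp (x + L a)) = 0"
      using B.exists_parallel_secant[OF genB L_mem[OF a_mem]] by blast
    then obtain y where y: "y \<in> mA" "x = f y" using f_surj by blast
    then have "x + L a = f (y + a)"
      using a_mem by (simp add: f_L L_add)
    then have "\<theta>A (A.alg_exp (y + a)) = 0" "\<theta>A (A.alg_exp y) = 0"
      using x y a_mem zero_iff by auto
    then show False
      using A.alg_exp_add_annihilator[OF y(1) a(2)] \<theta>a by (simp add: linear_add[OF \<theta>A])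
  qed
  have L_0: "L 0 = 0" using L_L0[of 0] \<open>L0 0 = 0\<close> by simp
  have "L a \<noteq> 0"
    using L_bij a(1) a_mem L_0 by (metis A.M_closed(1) bij_betw_def inj_onD)
  then have \<theta>La: "\<theta>B (L a) \<noteq> 0" using La genB by (auto simp: B.dual_generator_def)
  \<comment> \<open>The ratio of the slopes of the two defining functions along the annihilator
    directions.\<close>
  define c where "c = \<theta>B (L a) / \<theta>A a"
  have "c \<noteq> 0" using \<theta>a \<theta>La by (simp add: c_def)
  have key: "\<theta>B (B.alg_exp (f u)) = c * \<theta>A (A.alg_exp u)" if u: "u \<in> mA" for u
  proof -
    \<comment> \<open>Moving \<open>u\<close> by \<open>t\<close> times \<open>a\<close> reaches the
      hypersurface; \<open>f\<close> carries this to a move by \<open>t\<close> times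
      \<open>L a\<close>, which reaches the other one.\<close>
    define t where "t = - \<theta>A (A.alg_exp u) / \<theta>A a"
    have ta: "sA t a \<in> annihilator mA" "sB t (L a) \<in> annihilator mB" "sA t a \<in> mA"
      using a La a_mem A.scale_mem_annihilator B.scale_mem_annihilator by auto
    have "\<theta>A (A.alg_exp (u + sA t a)) = 0"
      using A.alg_exp_add_annihilator[OF u ta(1)] \<theta>a
      by (simp add: linear_diff[OF \<theta>A] linear_scale[OF \<theta>A] t_def)
    then have "\<theta>B (B.alg_exp (f (u + sA t a))) = 0"
      using zero_iff u ta by simp
    moreover have "f (u + sA t a) = f u + sB t (L a)"
      using u ta a_mem by (simp add: f_L L_add L_scale)
    ultimately have "\<theta>B (B.alg_exp (f u)) + t * \<theta>B (L a) = 0"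
      using B.alg_exp_add_annihilator[OF f_mem[OF u] ta(2)]
      by (simp add: linear_add[OF \<theta>B] linear_scale[OF \<theta>B])
    then show ?thesis by (simp add: t_def c_def field_simps)
  qed
  \<comment> \<open>The factor \<open>alg_exp b\<close> absorbs the translation and the division
    absorbs \<open>c\<close>. On the annihilator \<open>alg_exp b\<close> acts as the identity, so
    the result is again a dual generator.\<close>
  define \<theta> where "\<theta> x = \<theta>B (x * B.alg_exp b) / c" for x
  have "Vector_Spaces.linear sB (*) \<theta>"
    by (intro B.linear_functionalI) (simp_all add: \<theta>_def distrib_right linear_add[OF \<theta>B]
        B.scale_mult_left linear_scale[OF \<theta>B] add_divide_distrib)
  moreover have "x = 0" if x: "x \<in> annihilator mB" "\<theta> x = 0" for x
  proof -
    have "x * (B.alg_exp b - 1) = 0"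
      using x b B.alg_exp_minus_1_mem_M B.annihilator_memD(2) by blast
    then have "x * B.alg_exp b = x" by (simp add: right_diff_distrib)
    with x \<open>c \<noteq> 0\<close> genB show ?thesis by (simp add: \<theta>_def B.dual_generator_def)
  qed
  ultimately have gen: "B.dual_generator \<theta>" by (auto simp: B.dual_generator_def)
  have "\<theta> (B.alg_exp (L u)) = \<theta>A (A.alg_exp u)" if "u \<in> mA" for u
    using key[OF that] B.alg_exp_add[OF L_mem[OF that] b] \<open>c \<noteq> 0\<close>
    by (simp add: \<theta>_def f_L[OF that])
  then have "L (u * v) = L u * L v" if "u \<in> mA" "v \<in> mA" for u v
    using alg_exp_intertwining_imp_mult[OF L _ \<theta>A gen _ that] L_bij by (auto simp: bij_betw_def)
  with L L_bij show ?thesis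
    by (simp add: algebra_iso_on_def L_def)
qed

end

theorem theorem2p1:
  fixes sA :: "'k::field_char_0 \<Rightarrow> 'a::comm_ring_1 \<Rightarrow> 'a"
    and sB :: "'k \<Rightarrow> 'b::comm_ring_1 \<Rightarrow> 'b"
    and mA :: "'a set" and mB :: "'b set"
    and \<pi>A :: "'a \<Rightarrow> 'a" and \<pi>B :: "'b \<Rightarrow> 'b"
  assumes "gorenstein_algebra sA mA" and "gorenstein_algebra sB mB"
    and "gorenstein_algebra.admissible_projection sA mA \<pi>A"
    and "gorenstein_algebra.admissible_projection sB mB \<pi>B"
  defines "SA \<equiv> gorenstein_algebra.hypersurface sA mA \<pi>A"
    and "SB \<equiv> gorenstein_algebra.hypersurface sB mB \<pi>B"
  shows "(algebras_isomorphic sA sB \<longleftrightarrow> affinely_equivalent sA mA SA sB mB SB) \<and>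
         (\<forall>f. affine_equivalence sA mA SA sB mB SB f \<longrightarrow>
              algebra_iso_on sA mA sB mB (linear_part f))"
proof -
  interpret gorenstein_algebra_pair sA mA sB mB
    using assms(1,2)
    by (simp add: gorenstein_algebra_pair_def gorenstein_algebra_char_0_def)
  obtain \<theta>A where A: "A.dual_generator \<theta>A" "\<And>x. \<pi>A x = 0 \<longleftrightarrow> \<theta>A x = 0"
    using A.admissible_projection_dual_generator assms(3) by blast
  obtain \<theta>B where B: "B.dual_generator \<theta>B" "\<And>x. \<pi>B x = 0 \<longleftrightarrow> \<theta>B x = 0"
    using B.admissible_projection_dual_generator assms(4) by blast
  \<comment> \<open>Only the zero set of the projection enters the hypersurface, and it is that of
    the functional.\<close>
  have SA: "SA = {u \<in> mA. \<theta>A (A.alg_exp u) = 0}"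
    by (simp add: SA_def A.hypersurface_eq A)
  have SB: "SB = {u \<in> mB. \<theta>B (B.alg_exp u) = 0}"
    by (simp add: SB_def B.hypersurface_eq B)
  have iso: "algebra_iso_on sA mA sB mB (linear_part f)"
    if "affine_equivalence sA mA SA sB mB SB f" for f
    using linear_part_affine_equivalence_is_iso[OF A(1) B(1)] that by (simp add: SA SB)
  then have "algebras_isomorphic sA sB" if "affinely_equivalent sA mA SA sB mB SB"
    using that algebras_isomorphic_if_iso_on_maximal_ideals by (auto simp: affinely_equivalent_def)
  moreover have "affinely_equivalent sA mA SA sB mB SB" if "algebras_isomorphic sA sB"
    using affinely_equivalent_if_isomorphic[OF that A(1) B(1)] by (simp add: SA SB)
  ultimately show ?thesis using iso by blast
qed

end
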